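(* Let $f:\mathbb{R}^n\to\mathbb{R}\cup\{\infty\}$ be a proper, lower semicontinuous, convex function with $\mathrm{dom}\,f$ unbounded. Then: (i) $\Phi_f(d)\le f^\circ(\infty;d)$ for every $d\in\mathbb{R}^n$; (ii) if $f$ is Lipschitz at infinity, then the inequality in (i) is an equality, i.e. $\Phi_f(d)=f^\circ(\infty;d)$ for every $d\in\mathbb{R}^n$.
   Context: $\mathrm{dom}\,f=\{x\mid f(x)<\infty\}$; $f$ is proper if $\mathrm{dom}\,f\ne\emptyset$; $\mathrm{epi}\,f=\{(x,r)\in\mathbb{R}^n\times\mathbb{R}\mid r\ge f(x)\}$. With $I=\{1,\dots,n\}$ selecting the $x$-coordinates in $\mathbb{R}^n\times\mathbb{R}$: $T(\infty_I;\mathrm{epi}\,f)$ is the set of $(w,\rho)$ such that for all sequences $(x_k,r_k)\in\mathrm{epi}\,f$ with $\|x_k\|\to\infty$ and all $t_k>0$ with $t_k\to0$ there exist $(w_k,\rho_k)\to(w,\rho)$ with $(x_k,r_k)+t_k(w_k,\rho_k)\in\mathrm{epi}\,f$ for all $k$. $\Phi_f(d):=\inf\{\alpha\in\mathbb{R}\mid(d,\alpha)\in T(\infty_I;\mathrm{epi}\,f)\}\in[-\infty,+\infty]$, with $\inf\emptyset=+\infty$. The Clarke directional derivative at infinity is $f^\circ(\infty;d):=\limsup\frac{f(x+td)-f(x)}{t}\in[-\infty,+\infty]$, the limsup taken over $x\in\mathrm{dom}\,f$, $\|x\|\to\infty$, $t\searrow0$ ($t>0$). $f$ is Lipschitz at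 infinity if there exist $L\ge0$, $\gamma>0$, $\rho>0$ such that for every $x\in\mathrm{dom}\,f$ with $\|x\|\ge\gamma$, $f$ is finite on the open ball $B(x;\rho)$ and $|f(y)-f(z)|\le L\|y-z\|$ for all $y,z\in B(x;\rho)$. *)

theory Defs
  imports "HOL-Analysis.Analysis"
begin

text \<open>
  Functions into the reals extended by \<open>+\<infinity>\<close> are rendered as \<open>ereal\<close>-valued functions; that they
  avoid \<open>-\<infinity>\<close> is stated separately as a hypothesis.
\<close>

definition effective_dom :: "('a \<Rightarrow> ereal) \<Rightarrow> 'a set" where
  "effective_dom f = {x. f x < \<infinity>}"

definition proper_fun :: "('a \<Rightarrow> ereal) \<Rightarrow> bool" where
  "proper_fun f \<longleftrightarrow> effective_dom f \<noteq> {}"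

definition epi :: "('a \<Rightarrow> ereal) \<Rightarrow> ('a \<times> real) set" where
  "epi f = {(x, r). f x \<le> ereal r}"

definition lower_semicontinuous :: "('a::topological_space \<Rightarrow> ereal) \<Rightarrow> bool" where
  "lower_semicontinuous f \<longleftrightarrow> (\<forall>x. f x \<le> Liminf (at x) f)"

text \<open>
  The library's \<open>convex_on\<close> is restricted to real-valued functions. No \<open>\<infinity> - \<infinity>\<close> arises on
  the right-hand side for functions that avoid \<open>-\<infinity>\<close>.
\<close>

definition convex_fun :: "('a::real_vector \<Rightarrow> ereal) \<Rightarrow> bool" where
  "convex_fun f \<longleftrightarrow>
     (\<forall>x y. \<forall>u::real. 0 < u \<and> u < 1 \<longrightarrow>
        f ((1 - u) *\<^sub>R x + u *\<^sub>R y) \<le> ereal (1 - u) * f x + ereal u * f y)"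

text \<open>
  \<open>T(\<infinity>\<^sub>I; C)\<close>, where the index set \<open>I\<close> selects the coordinates of the first factor: only that
  component of the base points is required to tend to infinity.
\<close>

definition tangent_cone_at_infinity ::
    "('a::real_normed_vector \<times> 'b::real_normed_vector) set \<Rightarrow> ('a \<times> 'b) set" where
  "tangent_cone_at_infinity C =
     {(w, \<rho>). \<forall>(x :: nat \<Rightarrow> 'a) (r :: nat \<Rightarrow> 'b) (t :: nat \<Rightarrow> real).
        (\<forall>k. (x k, r k) \<in> C) \<and> filterlim (\<lambda>k. norm (x k)) at_top sequentially \<and>
        (\<forall>k. t k > 0) \<and> t \<longlonglongrightarrow> 0 \<longrightarrow>
        (\<exists>(w' :: nat \<Rightarrow> 'a) (\<rho>' :: nat \<Rightarrow> 'b).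
           (\<lambda>k. (w' k, \<rho>' k)) \<longlonglongrightarrow> (w, \<rho>) \<and>
           (\<forall>k. (x k, r k) + t k *\<^sub>R (w' k, \<rho>' k) \<in> C))}"

definition Phi :: "('a::real_normed_vector \<Rightarrow> ereal) \<Rightarrow> 'a \<Rightarrow> ereal" where
  "Phi f d = Inf {ereal \<alpha> | \<alpha>. (d, \<alpha>) \<in> tangent_cone_at_infinity (epi f)}"

definition clarke_deriv_at_infinity ::
    "('a::real_normed_vector \<Rightarrow> ereal) \<Rightarrow> 'a \<Rightarrow> ereal" where
  "clarke_deriv_at_infinity f d =
     Limsup (inf at_infinity (principal (effective_dom f)) \<times>\<^sub>F at_right (0::real))
       (\<lambda>(x, t). (f (x + t *\<^sub>R d) - f x) / ereal t)"

text \<open>The finiteness clause ensures that \<open>f y - f z\<close> below is a difference of real numbers.\<close>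

definition lipschitz_at_infinity :: "('a::real_normed_vector \<Rightarrow> ereal) \<Rightarrow> bool" where
  "lipschitz_at_infinity f \<longleftrightarrow>
     (\<exists>(L::real) (\<gamma>::real) (\<rho>::real). L \<ge> 0 \<and> \<gamma> > 0 \<and> \<rho> > 0 \<and>
        (\<forall>x \<in> effective_dom f. norm x \<ge> \<gamma> \<longrightarrow>
           (\<forall>y \<in> ball x \<rho>. \<bar>f y\<bar> \<noteq> \<infinity>) \<and>
           (\<forall>y \<in> ball x \<rho>. \<forall>z \<in> ball x \<rho>. \<bar>f y - f z\<bar> \<le> ereal (L * norm (y - z)))))"

end

theory Submission
  imports Defs
begin

text \<open>
  A real \<open>\<alpha>\<close> strictly above the Clarke derivative bounds all difference quotients in direction \<open>d\<close>
  far out and for small \<open>t\<close>, so the constant choice \<open>(d, \<alpha>)\<close> witnesses tangency for all large \<open>k\<close>.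
  Conversely, if \<open>(d, \<alpha>)\<close> is tangent, a bad sequence \<open>(x\<^sub>k, t\<^sub>k)\<close> for the upper limit yields
  approximations \<open>(w\<^sub>k, \<rho>\<^sub>k)\<close> of \<open>(d, \<alpha>)\<close>; replacing \<open>w\<^sub>k\<close> by \<open>d\<close> costs at most
  \<open>L \<parallel>w\<^sub>k - d\<parallel>\<close> in the difference quotient, which tends to zero.
\<close>

text \<open>The sets \<open>{x \<in> D. b \<le> norm x}\<close> times the intervals from
  \<open>0\<close> to \<open>\<delta>\<close> form a base of the filter behind the Clarke
  derivative. The explicit \<open>b\<close> and \<open>\<delta>\<close> can be applied along
  sequences, and the negated form produces a bad sequence.\<close>

lemma eventually_at_infinity_within_prod_at_right_0:
  fixes D :: "'a::real_normed_vector set"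
  shows "eventually P (inf at_infinity (principal D) \<times>\<^sub>F at_right (0::real)) \<longleftrightarrow>
    (\<exists>b. \<exists>\<delta>>0. \<forall>x\<in>D. \<forall>t. b \<le> norm x \<and> 0 < t \<and> t < \<delta> \<longrightarrow> P (x, t))"
    (is "?L \<longleftrightarrow> ?R")
proof
  assume ?L
  then obtain Q R where Q: "eventually Q (inf at_infinity (principal D))"
    and R: "eventually R (at_right (0::real))" and P: "\<And>x t. Q x \<Longrightarrow> R t \<Longrightarrow> P (x, t)"
    unfolding eventually_prod_filter by blast
  from Q obtain b where "\<And>x. b \<le> norm x \<Longrightarrow> x \<in> D \<Longrightarrow> Q x"
    by (auto simp: eventually_inf_principal eventually_at_infinity)
  moreover from R obtain \<delta> where "\<delta> > 0" "\<And>t. 0 < t \<Longrightarrow> t < \<delta> \<Longrightarrow> R t"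
    by (auto simp: eventually_at_right_field)
  ultimately show ?R using P by blast
next
  assume ?R
  then obtain b \<delta> where "\<delta> > 0"
    and P: "\<And>x t. x \<in> D \<Longrightarrow> b \<le> norm x \<Longrightarrow> 0 < t \<Longrightarrow> t < \<delta> \<Longrightarrow> P (x, t)"
    by blast
  show ?L
    unfolding eventually_prod_filter
  proof (intro exI conjI allI impI)
    show "eventually (\<lambda>x. x \<in> D \<and> b \<le> norm x) (inf at_infinity (principal D))"
      by (auto simp: eventually_inf_principal eventually_at_infinity)
    show "eventually (\<lambda>t. 0 < t \<and> t < \<delta>) (at_right 0)"
      using \<open>\<delta> > 0\<close> by (auto simp: eventually_at_right_field)
  qed (use P in blast)
qed

text \<open>Base points of the epigraph may lie above the graph, hence \<open>r\<close> beside
  \<open>b\<close>; passing from \<open>b\<close> to \<open>r\<close> only weakens the bound. Since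
  \<open>b\<close> is finite here, \<open>a = \<infinity>\<close> would make the quotient
  infinite.\<close>

lemma ereal_le_if_difference_quotient_less:
  fixes a b :: ereal
  assumes "t > 0" and "b \<le> ereal r" and "b \<noteq> -\<infinity>" and "(a - b) / ereal t < ereal \<alpha>"
  shows "a \<le> ereal (r + t * \<alpha>)"
  using assms by (cases a; cases b) (auto simp: field_simps)

text \<open>Strictness matters: an upper limit strictly below \<alpha> gives a bound by \<alpha> on
  a whole set of the filter.\<close>

lemma tangent_cone_at_infinity_epiI:
  fixes f :: "'a::real_normed_vector \<Rightarrow> ereal"
  assumes ninf: "\<And>x. f x \<noteq> -\<infinity>" and less: "clarke_deriv_at_infinity f d < ereal \<alpha>"
  shows "(d, \<alpha>) \<in> tangent_cone_at_infinity (epi f)"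
proof -
  have "\<forall>\<^sub>F (x, t) in inf at_infinity (principal (effective_dom f)) \<times>\<^sub>F at_right 0.
      (f (x + t *\<^sub>R d) - f x) / ereal t < ereal \<alpha>"
    using Limsup_lessD[OF less[unfolded clarke_deriv_at_infinity_def]]
    by (simp add: case_prod_unfold)
  then obtain b \<delta> where "\<delta> > 0" and
    quot: "\<And>x t. x \<in> effective_dom f \<Longrightarrow> b \<le> norm x \<Longrightarrow> 0 < t \<Longrightarrow> t < \<delta>
      \<Longrightarrow> (f (x + t *\<^sub>R d) - f x) / ereal t < ereal \<alpha>"
    unfolding eventually_at_infinity_within_prod_at_right_0 by auto
  show ?thesis
    unfolding tangent_cone_at_infinity_def
  proof (clarify, goal_cases)
    case (1 x r t)
    have "\<forall>\<^sub>F k in sequentially. b \<le> norm (x k)"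
      using 1(2) by (simp add: filterlim_at_top)
    moreover have "\<forall>\<^sub>F k in sequentially. t k < \<delta>"
      using 1(4) \<open>\<delta> > 0\<close> by (rule order_tendstoD)
    ultimately have ev: "\<forall>\<^sub>F k in sequentially. (x k, r k) + t k *\<^sub>R (d, \<alpha>) \<in> epi f"
    proof eventually_elim
      case (elim k)
      have le: "f (x k) \<le> ereal (r k)"
        using 1(1) by (simp add: epi_def)
      then have "x k \<in> effective_dom f"
        by (auto simp: effective_dom_def intro: le_less_trans)
      then show ?case
        using ereal_le_if_difference_quotient_less[OF _ le ninf quot] 1(3) elim
        by (simp add: epi_def)
    qed
    \<comment> \<open>Tangency demands membership for every \<open>k\<close>. At the finitely many
      indices where \<open>(d, \<alpha>)\<close> may fail, the zero vector keeps the base point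
      itself, and the limit is unaffected.\<close>
    define w where "w k = (if (x k, r k) + t k *\<^sub>R (d, \<alpha>) \<in> epi f then (d, \<alpha>) else (0, 0))" for k
    have "w \<longlonglongrightarrow> (d, \<alpha>)"
      by (rule tendsto_eventually, rule eventually_mono[OF ev]) (simp add: w_def)
    moreover have "(x k, r k) + t k *\<^sub>R w k \<in> epi f" for k
      using 1(1) by (auto simp: w_def zero_prod_def[symmetric])
    ultimately show ?case
      by (intro exI[of _ "fst \<circ> w"] exI[of _ "snd \<circ> w"]) simp
  qed
qed

lemma Phi_le_clarke_deriv_at_infinity:
  fixes f :: "'a::real_normed_vector \<Rightarrow> ereal"
  assumes "\<And>x. f x \<noteq> -\<infinity>"
  shows "Phi f d \<le> clarke_deriv_at_infinity f d"
\<comment> \<open>Testing against real upper bounds also covers infinite values of the derivative;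
  the slack \<open>e\<close> below supplies the strict inequality that tangency requires.\<close>
proof (rule ereal_le_real)
  fix \<alpha> assume "clarke_deriv_at_infinity f d \<le> ereal \<alpha>"
  show "Phi f d \<le> ereal \<alpha>"
  proof (rule ereal_le_epsilon2)
    fix e :: real assume "0 < e"
    with \<open>clarke_deriv_at_infinity f d \<le> ereal \<alpha>\<close>
    have "clarke_deriv_at_infinity f d < ereal (\<alpha> + e)"
      by (auto intro: le_less_trans)
    from tangent_cone_at_infinity_epiI[OF assms this]
    have "Phi f d \<le> ereal (\<alpha> + e)"
      unfolding Phi_def by (intro Inf_lower) blast
    then show "Phi f d \<le> ereal \<alpha> + ereal e" by simp
  qed
qed

text \<open>This makes the derivative a lower bound of the set whose infimum is
  \<open>Phi f d\<close>.\<close>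

lemma clarke_deriv_at_infinity_le_of_tangent:
  fixes f :: "'a::real_normed_vector \<Rightarrow> ereal"
  assumes ninf: "\<And>x. f x \<noteq> -\<infinity>" and lip: "lipschitz_at_infinity f"
    and tangent: "(d, \<alpha>) \<in> tangent_cone_at_infinity (epi f)"
  shows "clarke_deriv_at_infinity f d \<le> ereal \<alpha>"
proof (rule ereal_le_epsilon2)
  fix e :: real assume "0 < e"
  \<comment> \<open>The gap between \<alpha> and \<beta> absorbs both the error of
    \<open>\<rho>' k\<close> and the cost of replacing \<open>w k\<close> by
    \<open>d\<close>.\<close>
  define \<beta> where "\<beta> = \<alpha> + e"
  let ?P = "\<lambda>(x, t). (f (x + t *\<^sub>R d) - f x) / ereal t \<le> ereal \<beta>"
  have "eventually ?P (inf at_infinity (principal (effective_dom f)) \<times>\<^sub>F at_right 0)"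
  proof (rule ccontr)
    assume "\<not> ?thesis"
    then have neg: "\<exists>x\<in>effective_dom f. \<exists>t. b \<le> norm x \<and> 0 < t \<and> t < \<delta> \<and> \<not> ?P (x, t)"
      if "\<delta> > 0" for b \<delta> :: real
      unfolding eventually_at_infinity_within_prod_at_right_0 using that by blast
    \<comment> \<open>The bounds \<open>k\<close> and \<open>1/(k+1)\<close> force
      \<open>norm (x k)\<close> to infinity and \<open>t k\<close> to zero; the successor keeps the
      second bound positive at \<open>k = 0\<close>.\<close>
    have "\<forall>k. \<exists>x t. x \<in> effective_dom f \<and> real k \<le> norm x \<and> 0 < t \<and> t < inverse (real (Suc k))
        \<and> \<not> ?P (x, t)"
    proof
      fix k
      have "0 < inverse (real (Suc k))" by simp
      from neg[OF this, of "real k"] show "\<exists>x t. x \<in> effective_dom f \<and> real k \<le> norm x \<and> 0 < t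
          \<and> t < inverse (real (Suc k)) \<and> \<not> ?P (x, t)" by blast
    qed
    then obtain x t where dom: "\<And>k. x k \<in> effective_dom f" and large: "\<And>k. real k \<le> norm (x k)"
      and t: "\<And>k. 0 < t k" "\<And>k. t k < inverse (real (Suc k))"
      and big: "\<And>k. \<not> ?P (x k, t k)"
      unfolding choice_iff by blast
    have x_lim: "filterlim (\<lambda>k. norm (x k)) at_top sequentially"
      by (rule filterlim_at_top_mono[OF filterlim_real_sequentially]) (simp add: large)
    have t_lim: "t \<longlonglongrightarrow> 0"
      by (rule tendsto_sandwich[OF _ _ tendsto_const LIMSEQ_inverse_real_of_nat])
        (auto intro!: always_eventually less_imp_le t simp del: of_nat_Suc)
    \<comment> \<open>Base points are taken on the graph, so that the epigraph inequality bounds an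
      increment of \<open>f\<close> itself.\<close>
    define r where "r k = real_of_ereal (f (x k))" for k
    have fx: "f (x k) = ereal (r k)" for k
      using dom[of k] ninf[of "x k"] by (cases "f (x k)") (auto simp: r_def effective_dom_def)
    obtain w \<rho>' where w_lim: "(\<lambda>k. (w k, \<rho>' k)) \<longlonglongrightarrow> (d, \<alpha>)"
      and w: "\<And>k. (x k, r k) + t k *\<^sub>R (w k, \<rho>' k) \<in> epi f"
    proof -
      have "(x k, r k) \<in> epi f" for k
        by (simp add: epi_def fx)
      then show ?thesis
        using tangent x_lim t_lim t(1) that unfolding tangent_cone_at_infinity_def by blast
    qed
    have wd: "w \<longlonglongrightarrow> d" and \<rho>': "\<rho>' \<longlonglongrightarrow> \<alpha>"
      using tendsto_fst[OF w_lim] tendsto_snd[OF w_lim] by simp_all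
    obtain L \<gamma> \<rho> where "\<rho> > 0" and lip': "\<forall>x\<in>effective_dom f. norm x \<ge> \<gamma> \<longrightarrow>
        (\<forall>y\<in>ball x \<rho>. \<bar>f y\<bar> \<noteq> \<infinity>) \<and>
        (\<forall>y\<in>ball x \<rho>. \<forall>z\<in>ball x \<rho>. \<bar>f y - f z\<bar> \<le> ereal (L * norm (y - z)))"
      using lip unfolding lipschitz_at_infinity_def by blast
    then have fin: "x \<in> effective_dom f \<Longrightarrow> \<gamma> \<le> norm x \<Longrightarrow> y \<in> ball x \<rho> \<Longrightarrow> \<bar>f y\<bar> \<noteq> \<infinity>"
      and L: "x \<in> effective_dom f \<Longrightarrow> \<gamma> \<le> norm x \<Longrightarrow> y \<in> ball x \<rho> \<Longrightarrow> z \<in> ball x \<rho>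
        \<Longrightarrow> \<bar>f y - f z\<bar> \<le> ereal (L * norm (y - z))"
      for x y z
      by (simp_all del: mem_ball)
    have "(\<lambda>k. \<rho>' k + L * norm (d - w k)) \<longlonglongrightarrow> \<alpha> + L * norm (d - d)"
      by (intro tendsto_intros \<rho>' wd)
    then have "\<forall>\<^sub>F k in sequentially. \<rho>' k + L * norm (d - w k) < \<beta>"
      by (rule order_tendstoD) (use \<open>0 < e\<close> in \<open>simp add: \<beta>_def\<close>)
    \<comment> \<open>Both displaced points must enter the ball of radius \<rho> about
      \<open>x k\<close>, where the Lipschitz estimate applies.\<close>
    moreover have "(\<lambda>k. norm (t k *\<^sub>R d)) \<longlonglongrightarrow> norm (0 *\<^sub>R d)"
      by (intro tendsto_intros t_lim)
    then have "\<forall>\<^sub>F k in sequentially. norm (t k *\<^sub>R d) < \<rho>"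
      by (rule order_tendstoD) (use \<open>\<rho> > 0\<close> in simp)
    moreover have "(\<lambda>k. norm (t k *\<^sub>R w k)) \<longlonglongrightarrow> norm (0 *\<^sub>R d)"
      by (intro tendsto_intros t_lim wd)
    then have "\<forall>\<^sub>F k in sequentially. norm (t k *\<^sub>R w k) < \<rho>"
      by (rule order_tendstoD) (use \<open>\<rho> > 0\<close> in simp)
    moreover have "\<forall>\<^sub>F k in sequentially. \<gamma> \<le> norm (x k)"
      using x_lim by (simp add: filterlim_at_top)
    ultimately have "\<forall>\<^sub>F k in sequentially. False"
    proof eventually_elim
      case (elim k)
      let ?y = "x k + t k *\<^sub>R d" and ?z = "x k + t k *\<^sub>R w k"
      have y: "?y \<in> ball (x k) \<rho>" and z: "?z \<in> ball (x k) \<rho>"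
        using elim(2,3) by (simp_all add: dist_norm)
      obtain a where a: "f ?y = ereal a"
        using fin[OF dom elim(4) y] by auto
      obtain c where c: "f ?z = ereal c"
        using fin[OF dom elim(4) z] by auto
      have "?y - ?z = t k *\<^sub>R (d - w k)"
        by (simp add: scaleR_diff_right)
      then have "norm (?y - ?z) = t k * norm (d - w k)"
        using t(1)[of k] by simp
      then have "\<bar>a - c\<bar> \<le> L * (t k * norm (d - w k))"
        using L[OF dom elim(4) y z] a c by simp
      moreover have "c \<le> r k + t k * \<rho>' k"
        using w[of k] c by (simp add: epi_def)
      \<comment> \<open>The epigraph bound at \<open>?z\<close> and the Lipschitz bound between
        \<open>?y\<close> and \<open>?z\<close> add up.\<close>
      ultimately have "a - r k \<le> t k * (\<rho>' k + L * norm (d - w k))"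
        by (simp add: algebra_simps)
      also have "\<dots> \<le> t k * \<beta>"
        using elim(1) t(1)[of k] by simp
      finally have "(a - r k) / t k \<le> \<beta>"
        using t(1)[of k] by (simp add: field_simps)
      then show False
        using big[of k] a fx[of k] t(1)[of k] by simp
    qed
    then show False by simp
  qed
  then show "clarke_deriv_at_infinity f d \<le> ereal \<alpha> + ereal e"
    unfolding clarke_deriv_at_infinity_def
    by (intro Limsup_bounded) (simp add: \<beta>_def case_prod_unfold)
qed

theorem proposition4p27:
  fixes f :: "real ^ 'n \<Rightarrow> ereal"
  assumes "\<And>x. f x \<noteq> -\<infinity>"
    and "proper_fun f"
    and "lower_semicontinuous f"
    and "convex_fun f"
    and "\<not> bounded (effective_dom f)"
  shows "(\<forall>d. Phi f d \<le> clarke_deriv_at_infinity f d) \<and>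
    (lipschitz_at_infinity f \<longrightarrow> (\<forall>d. Phi f d = clarke_deriv_at_infinity f d))"
proof (intro conjI impI allI)
  show le: "Phi f d \<le> clarke_deriv_at_infinity f d" for d
    using assms(1) by (rule Phi_le_clarke_deriv_at_infinity)
  fix d assume "lipschitz_at_infinity f"
  then have "clarke_deriv_at_infinity f d \<le> ereal \<alpha>"
    if "(d, \<alpha>) \<in> tangent_cone_at_infinity (epi f)" for \<alpha>
    using assms(1) that by (intro clarke_deriv_at_infinity_le_of_tangent)
  \<comment> \<open>If no \<alpha> is tangent, the infimum is \<infinity> and the inequality is
    trivial.\<close>
  then have "clarke_deriv_at_infinity f d \<le> Phi f d"
    unfolding Phi_def by (blast intro: Inf_greatest)
  with le show "Phi f d = clarke_deriv_at_infinity f d" by (rule antisym)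
qed

end
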